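(* For every integer $n\ge0$ and every integer $N\ge1$, the following identity holds (as rational functions in $x$): $$\begin{aligned} &2^{N+1}N!\sum_{s+m+p=n}\binom{N+s}{s}\binom{m+N}{m}(-1)^{m}\,T_{p}^{(N+1)}(x)\\ &=\sum_{i=1}^{N}\sum_{l=0}^{i}a_{i}(N)\frac{i!}{l!}\sum_{m+s+p=n}\binom{2N+m-i-1}{m}\binom{i+s-l}{s}(p+l)_{l}\,x^{i-2N-m}\,T_{p+l}(x)\\ &\quad+\sum_{i=1}^{N}\sum_{l=0}^{i}a_{i}(N)\frac{i!}{l!}(-1)^{i-l}\sum_{m+s+p=n}(-1)^{s}\binom{2N+m-i-1}{m}\binom{i+s-l}{s}(p+l)_{l}\,x^{i-2N-m}\,T_{p+l}(x), \end{aligned}$$ where the sums over $m+s+p=n$ are over all integers $m,s,p\ge0$ with $m+s+p=n$.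
   Context: The polynomials $T_n(x)$ (Chebyshev polynomials of the first kind, in the normalization used here) and the higher-order ones $T_n^{(\alpha)}(x)$ are defined by the formal power series in $t$ $$\frac{1-t^{2}}{1-2xt+t^{2}}=\sum_{n=0}^{\infty}T_{n}(x)t^{n},\qquad \left(\frac{1-t^{2}}{1-2xt+t^{2}}\right)^{\alpha}=\sum_{n=0}^{\infty}T_{n}^{(\alpha)}(x)t^{n}.$$ (With this definition $T_0=1$, and for $n\ge1$ $T_n$ is twice the classical polynomial $\cos(n\arccos x)$.) For a number $y$ and integer $n\ge1$, $(y)_{n}=y(y-1)\cdots(y-n+1)$ is the falling factorial, and $(y)_{0}=1$. The double factorial is $(2k-1)!!=(2k-1)(2k-3)\cdots 3\cdot 1$ for $k\ge1$, with $(-1)!!=1$. The numbers $a_i(N)$, $1\le i\le N$, are defined by $a_{1}(N)=(2N-3)!!$ and, for $2\le i\le N$, $$a_{i}(N)=\sum_{k_{i-1}=0}^{N-i}\ \sum_{k_{i-2}=0}^{N-i-k_{i-1}}\cdots\sum_{k_{1}=0}^{N-i-k_{i-1}-\cdots-k_{2}}2^{\sum_{j=1}^{i-1}k_{j}}\left[\prod_{j=2}^{i}\left(N-\sum_{l=j}^{i-1}k_{l}-\frac{2i+2-j}{2}\right)_{k_{j-1}}\right]\left(2\left(N-i-\sum_{j=1}^{i-1}k_{j}\right)-1\right)!!,$$ where empty sums are $0$. *)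

theory Defs
  imports "HOL-Computational_Algebra.Computational_Algebra"
begin

text \<open>
  Power series in \<open>t\<close> are series over the polynomial ring in \<open>x\<close>, so that the
  \<open>T\<close> are genuinely polynomials. The denominator has constant coefficient \<open>1\<close> and
  is hence invertible; \<open>fps_right_inverse\<close> is used because the type class
  \<open>inverse\<close> is not available for polynomials.
\<close>

definition cheb_denom :: "'a::field_char_0 poly fps" where
  "cheb_denom = 1 - fps_const (2 * [:0, 1:]) * fps_X + fps_X ^ 2"

definition cheb_gf :: "'a::field_char_0 poly fps" where
  "cheb_gf = (1 - fps_X ^ 2) * fps_right_inverse cheb_denom 1"

lemma cheb_gf_mult_denom: "cheb_gf * cheb_denom = 1 - fps_X ^ 2"
proof -
  have "cheb_denom * fps_right_inverse cheb_denom 1 = (1 :: 'a poly fps)"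
    by (rule fps_right_inverse) (simp add: cheb_denom_def)
  then show ?thesis
    by (simp add: cheb_gf_def mult.assoc mult.commute[of _ cheb_denom])
qed

definition cheb_T :: "nat \<Rightarrow> 'a::field_char_0 poly" where
  "cheb_T n = fps_nth cheb_gf n"

definition cheb_T_ord :: "nat \<Rightarrow> nat \<Rightarrow> 'a::field_char_0 poly" where
  "cheb_T_ord \<alpha> n = fps_nth (cheb_gf ^ \<alpha>) n"

definition falling :: "'a::comm_ring_1 \<Rightarrow> nat \<Rightarrow> 'a" where
  "falling y n = (\<Prod>k<n. y - of_nat k)"

text \<open>\<open>odd_dfact k\<close> is \<open>(2k - 1)!!\<close>; in particular \<open>odd_dfact 0\<close> is \<open>(-1)!! = 1\<close>.\<close>

definition odd_dfact :: "nat \<Rightarrow> nat" where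
  "odd_dfact k = (\<Prod>j = 1..k. 2 * j - 1)"

text \<open>
  \<open>nested_sum r M f\<close> is the iterated sum of \<open>f (k\<^sub>1, ..., k\<^sub>r)\<close> over
  \<open>0 \<le> k\<^sub>r \<le> M\<close>, then \<open>0 \<le> k\<^bsub>r-1\<^esub> \<le> M - k\<^sub>r\<close>, down to
  \<open>0 \<le> k\<^sub>1 \<le> M - k\<^sub>r - ... - k\<^sub>2\<close>. The index tuple is a function that is \<open>0\<close>
  outside \<open>{1..r}\<close>.
\<close>

primrec nested_sum :: "nat \<Rightarrow> nat \<Rightarrow> ((nat \<Rightarrow> nat) \<Rightarrow> 'b::comm_monoid_add) \<Rightarrow> 'b" where
  "nested_sum 0 M f = f (\<lambda>_. 0)"
| "nested_sum (Suc r) M f =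
     (\<Sum>v = 0..M. nested_sum r (M - v) (\<lambda>k. f (k(Suc r := v))))"

text \<open>
  Meaningful for \<open>1 \<le> i \<le> N\<close>; on the range of summation the natural-number
  subtractions \<open>N - i - (\<Sum>j = 1..i-1. k j)\<close> and \<open>N - 1\<close> do not truncate.
\<close>

definition coeff_a :: "nat \<Rightarrow> nat \<Rightarrow> 'a::field_char_0" where
  "coeff_a i N =
    (if i = 1 then of_nat (odd_dfact (N - 1))
     else nested_sum (i - 1) (N - i) (\<lambda>k.
       2 ^ (\<Sum>j = 1..i-1. k j) *
       (\<Prod>j = 2..i. falling (of_nat N - of_nat (\<Sum>l = j..i-1. k l)
                               - (2 * of_nat i + 2 - of_nat j) / 2) (k (j - 1))) *
       of_nat (odd_dfact (N - i - (\<Sum>j = 1..i-1. k j)))))"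

definition ratfun_x :: "'a::field_char_0 poly fract" where
  "ratfun_x = to_fract [:0, 1:]"

abbreviation ratfun_const :: "'a::field_char_0 \<Rightarrow> 'a poly fract" where
  "ratfun_const c \<equiv> to_fract [:c:]"

end

theory Submission
  imports Defs
begin

text \<open>
  Let \<open>F = 1 / (1 - 2xt + t\<^sup>2)\<close> and \<open>G = (1 - t\<^sup>2) F\<close>, with derivatives taken in \<open>t\<close>.
  From \<open>F' = 2 (x - t) F\<^sup>2\<close> one gets by induction on \<open>N\<close>
  \<open>2\<^sup>N N! F\<^bsup>N+1\<^esup> = (\<Sum>i = 1..N. a\<^sub>i(N) (x - t)\<^bsup>i-2N\<^esup> F\<^bsup>(i)\<^esup>)\<close>, where the coefficients obey
  \<open>a\<^sub>i(N+1) = (2N - i) a\<^sub>i(N) + a\<^bsub>i-1\<^esub>(N)\<close>; unrolling this recurrence in \<open>N\<close> gives the nested sum.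
  The left-hand side of the theorem is the \<open>n\<close>-th coefficient of \<open>2\<^bsup>N+1\<^esup> N! F\<^bsup>N+1\<^esup>\<close>, since
  \<open>F\<^bsup>N+1\<^esup> = (1 - t)\<^bsup>-N-1\<^esup> (1 + t)\<^bsup>-N-1\<^esup> G\<^bsup>N+1\<^esup>\<close>. The two sums on the right come from applying
  the Leibniz rule to \<open>2 F = G / (1 - t) + G / (1 + t)\<close>.
\<close>

section \<open>Recurrence for the coefficients\<close>

lemma nested_sum_distrib_left:
  fixes c :: "'b::semiring_0"
  shows "c * nested_sum r M f = nested_sum r M (\<lambda>k. c * f k)"
  by (induction r arbitrary: M f) (simp_all add: sum_distrib_left)

lemma falling_Suc: "falling y (Suc k) = y * falling (y - 1) k"
  unfolding falling_def by (subst prod.lessThan_Suc_shift) (simp add: algebra_simps)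

text \<open>The summand of \<open>coeff_a\<close> gets a name so that the effect of fixing its
  outermost index can be stated on its own.\<close>

definition coeff_a_term :: "nat \<Rightarrow> nat \<Rightarrow> (nat \<Rightarrow> nat) \<Rightarrow> 'a::field_char_0" where
  "coeff_a_term i N k =
     2 ^ (\<Sum>j = 1..i-1. k j) *
     (\<Prod>j = 2..i. falling (of_nat N - of_nat (\<Sum>l = j..i-1. k l)
                             - (2 * of_nat i + 2 - of_nat j) / 2) (k (j - 1))) *
     of_nat (odd_dfact (N - i - (\<Sum>j = 1..i-1. k j)))"

text \<open>For \<open>i = 1\<close> the index tuple, the sum and the product are all empty and only
  (2N-3)!! remains, so the separate clause of \<open>coeff_a\<close> is an instance of the general
  formula.\<close>

lemma coeff_a_eq_nested_sum:
  "1 \<le> i \<Longrightarrow> coeff_a i N = nested_sum (i - 1) (N - i) (coeff_a_term i N)"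
  unfolding coeff_a_def coeff_a_term_def[abs_def] by (cases "i = 1") (simp_all add: odd_dfact_def)

text \<open>With the outermost index fixed to \<open>v\<close>, the factor for j = i + 1 contains no
  other index and splits off. In every other factor, \<open>v\<close> and the passage from i + 1 to
  i together lower the argument by v + 1, which amounts to replacing N by N - 1 - v.\<close>

lemma coeff_a_term_Suc:
  assumes "v < N" and "1 \<le> i"
  shows "coeff_a_term (Suc i) N (k(i := v)) =
    2 ^ v * falling (of_nat N - 1 - of_nat (Suc i) / 2) v
      * (coeff_a_term i (N - 1 - v) k :: 'a::field_char_0)"
proof -
  have sum_upd: "(\<Sum>l = j..i. (k(i := v)) l) = (\<Sum>l = j..i-1. k l) + v" if "j \<le> i" for j
  proof -
    have "{j..i} = insert i {j..i-1}" using that assms(2) by auto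
    moreover have "(\<Sum>l = j..i-1. (k(i := v)) l) = (\<Sum>l = j..i-1. k l)"
      by (rule sum.cong) (use assms(2) in auto)
    moreover have "sum (k(i := v)) (insert i {j..i-1}) = (k(i := v)) i + sum (k(i := v)) {j..i-1}"
      by (rule sum.insert) (use assms(2) in auto)
    ultimately show ?thesis by (simp only: fun_upd_same add.commute)
  qed
  define h :: "nat \<Rightarrow> 'a" where
    "h j = falling (of_nat N - of_nat (\<Sum>l = j..i. (k(i := v)) l)
             - (2 * of_nat (Suc i) + 2 - of_nat j) / 2) ((k(i := v)) (j - 1))" for j
  have h_last: "h (Suc i) = falling (of_nat N - 1 - of_nat (Suc i) / 2) v"
    by (simp add: h_def field_simps)
  have h_init: "h j = falling (of_nat (N - 1 - v) - of_nat (\<Sum>l = j..i-1. k l)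
             - (2 * of_nat i + 2 - of_nat j) / 2) (k (j - 1))" if "j \<in> {2..i}" for j
  proof -
    \<comment> \<open>By \<open>v < N\<close> the subtraction does not truncate.\<close>
    have sub: "(of_nat (N - 1 - v) :: 'a) = of_nat N - 1 - of_nat v"
      using assms(1) by (simp add: of_nat_diff)
    have "of_nat N - of_nat ((\<Sum>l = j..i-1. k l) + v) - (2 * of_nat (Suc i) + 2 - of_nat j) / 2
      = (of_nat (N - 1 - v) - of_nat (\<Sum>l = j..i-1. k l) - (2 * of_nat i + 2 - of_nat j) / 2 :: 'a)"
      unfolding sub by (simp add: field_simps)
    moreover have "(k(i := v)) (j - 1) = k (j - 1)" using that by auto
    moreover have "(\<Sum>l = j..i. (k(i := v)) l) = (\<Sum>l = j..i-1. k l) + v"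
      using that by (intro sum_upd) simp
    ultimately show ?thesis
      unfolding h_def by (simp only:)
  qed
  have "(\<Prod>j = 2..Suc i. h j) = h (Suc i) * (\<Prod>j = 2..i. h j)"
    using assms(2) by (intro prod.nat_ivl_Suc') auto
  moreover have "(\<Prod>j = 2..i. h j) =
      (\<Prod>j = 2..i. falling (of_nat (N - 1 - v) - of_nat (\<Sum>l = j..i-1. k l)
             - (2 * of_nat i + 2 - of_nat j) / 2) (k (j - 1)))"
    by (rule prod.cong[OF refl h_init])
  ultimately have prod_h: "(\<Prod>j = 2..Suc i. h j) =
      falling (of_nat N - 1 - of_nat (Suc i) / 2) v *
      (\<Prod>j = 2..i. falling (of_nat (N - 1 - v) - of_nat (\<Sum>l = j..i-1. k l)
             - (2 * of_nat i + 2 - of_nat j) / 2) (k (j - 1)))"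
    by (simp only: h_last)
  have sub: "N - Suc i - ((\<Sum>l = 1..i-1. k l) + v) = N - 1 - v - i - (\<Sum>l = 1..i-1. k l)"
    by simp
  show ?thesis
    unfolding coeff_a_term_def diff_Suc_1 h_def[symmetric] prod_h sum_upd[OF assms(2)] sub
    by (simp only: power_add mult_ac)
qed

text \<open>The outermost summation is peeled off. The bound left for the inner sums is N - 1 - v -
  i, exactly the one belonging to \<open>coeff_a i (N - 1 - v)\<close>.\<close>

lemma coeff_a_Suc:
  assumes "1 \<le> i" "Suc i \<le> N"
  shows "(coeff_a (Suc i) N :: 'a::field_char_0) =
    (\<Sum>v = 0..N - Suc i. 2 ^ v * falling (of_nat N - 1 - of_nat (Suc i) / 2) v * coeff_a i (N - 1 - v))"
proof -
  obtain r where r: "i = Suc r" using assms(1) by (cases i) auto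
  have "coeff_a (Suc i) N =
      (\<Sum>v = 0..N - Suc i. nested_sum r (N - Suc i - v) (\<lambda>k. coeff_a_term (Suc i) N (k(i := v)) :: 'a))"
    by (simp add: coeff_a_eq_nested_sum r)
  also have "\<dots> = (\<Sum>v = 0..N - Suc i. 2 ^ v * falling (of_nat N - 1 - of_nat (Suc i) / 2) v
                       * coeff_a i (N - 1 - v))"
  proof (rule sum.cong[OF refl])
    fix v assume "v \<in> {0..N - Suc i}"
    then have v: "v < N" "N - Suc i - v = N - 1 - v - i" using assms by auto
    show "nested_sum r (N - Suc i - v) (\<lambda>k. coeff_a_term (Suc i) N (k(i := v)) :: 'a) =
      2 ^ v * falling (of_nat N - 1 - of_nat (Suc i) / 2) v * coeff_a i (N - 1 - v)"
      unfolding coeff_a_term_Suc[OF v(1) assms(1)] v(2) coeff_a_eq_nested_sum[OF assms(1)]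
      by (simp add: nested_sum_distrib_left r)
  qed
  finally show ?thesis .
qed

text \<open>Setting \<open>a\<^sub>i(N) = 0\<close> outside \<open>1 \<le> i \<le> N\<close> makes the recurrence uniform in \<open>i\<close>.\<close>

definition coeff_a0 :: "nat \<Rightarrow> nat \<Rightarrow> 'a::field_char_0" where
  "coeff_a0 i N = (if 1 \<le> i \<and> i \<le> N then coeff_a i N else 0)"

lemma sum_atLeast0_atMost_Suc_head:
  fixes f :: "nat \<Rightarrow> 'b::comm_monoid_add"
  shows "(\<Sum>l = 0..Suc n. f l) = f 0 + (\<Sum>l = 0..n. f (Suc l))"
  by (simp only: sum.atLeast_Suc_atMost[of 0 "Suc n"] sum.shift_bounds_cl_Suc_ivl zero_le)

text \<open>In the expansion of a_i(N+1) by \<open>coeff_a_Suc\<close>, the term v = 0 is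
  a_{i-1}(N). By \<open>falling_Suc\<close>, each term v + 1 is 2 (N - i/2) = 2N - i times the term
  v of the expansion of a_i(N). For i = 1 the claim is (2N-1)!! = (2N-1) (2N-3)!!.\<close>

lemma coeff_a0_rec:
  assumes "1 \<le> N" "1 \<le> i" "i \<le> Suc N"
  shows "coeff_a0 i (Suc N) = of_nat (2 * N - i) * coeff_a0 i N + (coeff_a0 (i - 1) N :: 'a::field_char_0)"
proof (cases "i = 1")
  case True
  obtain M where M: "N = Suc M" using assms(1) by (cases N) auto
  have "odd_dfact N = (2 * N - 1) * odd_dfact (N - 1)"
    unfolding M odd_dfact_def by (simp add: mult.commute)
  then have "(of_nat (odd_dfact N) :: 'a) = of_nat (2 * N - 1) * of_nat (odd_dfact (N - 1))"
    by (metis of_nat_mult)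
  then show ?thesis
    using True assms by (simp add: coeff_a0_def coeff_a_def)
next
  case False
  then obtain r where i: "i = Suc r" "1 \<le> r" using assms by (cases i) auto
  define c :: "nat \<Rightarrow> nat \<Rightarrow> 'a" where
    "c M v = 2 ^ v * falling (of_nat M - 1 - of_nat i / 2) v * coeff_a r (M - 1 - v)" for M v
  have exp: "coeff_a i M = (\<Sum>v = 0..M - i. c M v)" if "i \<le> M" for M
    using coeff_a_Suc[of r M] i that by (simp add: c_def)
  have "c (Suc N) (Suc v) = of_nat (2 * N - i) * c N v" if "i \<le> N" for v
  proof -
    have two: "of_nat (2 * N - i) = (2 * (of_nat N - of_nat i / 2) :: 'a)"
      using that by (simp add: of_nat_diff algebra_simps)
    have shift: "of_nat (Suc N) - 1 - of_nat i / 2 = (of_nat N - of_nat i / 2 :: 'a)"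
      "of_nat N - of_nat i / 2 - 1 = (of_nat N - 1 - of_nat i / 2 :: 'a)"
      "Suc N - 1 - Suc v = N - 1 - v"
      by simp_all
    show ?thesis
      unfolding c_def falling_Suc two shift by (simp only: power_Suc mult_ac)
  qed
  moreover have "c (Suc N) 0 = coeff_a r N"
    by (simp add: c_def falling_def)
  moreover have "(\<Sum>v = 0..Suc N - i. c (Suc N) v) = c (Suc N) 0 + (\<Sum>v = 0..N - i. c (Suc N) (Suc v))"
    if "i \<le> N"
    unfolding Suc_diff_le[OF that] by (rule sum_atLeast0_atMost_Suc_head)
  \<comment> \<open>For i = N + 1 only the term v = 0 is present, in accordance with the padding of
    \<open>coeff_a0\<close> by zeros.\<close>
  ultimately have "(coeff_a i (Suc N) :: 'a) = coeff_a r N + (if i \<le> N then of_nat (2 * N - i) * coeff_a i N else 0)"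
    using assms exp[of "Suc N"] exp[of N]
    by (cases "i \<le> N") (auto simp: sum_distrib_left not_le le_Suc_eq)
  then show ?thesis
    using assms i by (auto simp: coeff_a0_def)
qed

section \<open>Derivatives and negative powers of power series\<close>

lemma fps_nth_deriv_nth:
  fixes f :: "'a::comm_ring_1 fps"
  shows "fps_nth_deriv l f $ p = falling (of_nat (p + l)) l * f $ (p + l)"
proof (induction l arbitrary: f)
  case 0
  then show ?case by (simp add: falling_def)
next
  case (Suc l)
  then show ?case by (simp add: falling_Suc mult_ac)
qed

lemma fps_nth_deriv_mult:
  fixes f g :: "'a::comm_ring_1 fps"
  shows "fps_nth_deriv n (f * g) =
    (\<Sum>l = 0..n. of_nat (n choose l) * (fps_nth_deriv l f * fps_nth_deriv (n - l) g))"
proof (induction n arbitrary: f g)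
  case 0
  then show ?case by simp
next
  case (Suc n)
  let ?D = "\<lambda>l m. fps_nth_deriv l f * fps_nth_deriv m g"
  have "fps_nth_deriv (Suc n) (f * g) = fps_deriv (fps_nth_deriv n (f * g))"
    by (simp add: fps_nth_deriv_commute del: fps_nth_deriv.simps)
  also have "\<dots> = (\<Sum>l = 0..n. of_nat (n choose l) * (?D (Suc l) (n - l) + ?D l (Suc (n - l))))"
    by (simp add: Suc fps_deriv_sum fps_nth_deriv_commute algebra_simps
          fps_of_nat[symmetric] del: fps_nth_deriv.simps fps_of_nat)
  \<comment> \<open>The second sum may run up to n + 1 because \<open>n choose Suc n\<close> is 0.
    Splitting off l = 0 then aligns it with the first sum, and Pascal's rule merges the two.\<close>
  also have "\<dots> = (\<Sum>l = 0..n. of_nat (n choose l) * ?D (Suc l) (n - l))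
      + (\<Sum>l = 0..Suc n. of_nat (n choose l) * ?D l (Suc n - l))"
    by (simp add: algebra_simps sum.distrib Suc_diff_le binomial_eq_0 del: fps_nth_deriv.simps)
  also have "\<dots> = (\<Sum>l = 0..n. of_nat (n choose l) * ?D (Suc l) (n - l))
      + (?D 0 (Suc n) + (\<Sum>l = 0..n. of_nat (n choose Suc l) * ?D (Suc l) (n - l)))"
    unfolding sum_atLeast0_atMost_Suc_head by (simp del: fps_nth_deriv.simps(2))
  also have "\<dots> = ?D 0 (Suc n) + (\<Sum>l = 0..n. of_nat (Suc n choose Suc l) * ?D (Suc l) (n - l))"
    by (simp add: algebra_simps sum.distrib del: fps_nth_deriv.simps(2))
  also have "\<dots> = (\<Sum>l = 0..Suc n. of_nat (Suc n choose l) * ?D l (Suc n - l))"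
    unfolding sum_atLeast0_atMost_Suc_head by (simp del: fps_nth_deriv.simps(2))
  finally show ?case .
qed

lemma fps_nth_mult3:
  fixes f g h :: "'a::comm_ring_1 fps"
  shows "(f * g * h) $ n = (\<Sum>(a, b, c) \<in> {(a, b, c). a + b + c = n}. f $ a * g $ b * h $ c)"
proof -
  have "(f * g * h) $ n = (f * (g * h)) $ n" by (simp add: mult.assoc)
  also have "\<dots> = (\<Sum>a = 0..n. \<Sum>b = 0..n - a. f $ a * g $ b * h $ (n - a - b))"
    by (simp add: fps_mult_nth sum_distrib_left mult.assoc)
  also have "\<dots> = (\<Sum>(a, b) \<in> (SIGMA a:{0..n}. {0..n - a}). f $ a * g $ b * h $ (n - a - b))"
    by (simp add: sum.Sigma)
  also have "\<dots> = (\<Sum>(a, b, c) \<in> {(a, b, c). a + b + c = n}. f $ a * g $ b * h $ c)"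
    by (rule sum.reindex_bij_witness[of _ "\<lambda>(a, b, c). (a, b)" "\<lambda>(a, b). (a, b, n - a - b)"]) auto
  finally show ?thesis .
qed

text \<open>This is the expansion of (1 - ct)^(-n-1). The offset in the exponent makes
  \<open>n = 0\<close> the geometric series, and explicit coefficients make sense over any
  commutative ring.\<close>

definition fps_neg_binom :: "'a::comm_ring_1 \<Rightarrow> nat \<Rightarrow> 'a fps" where
  "fps_neg_binom c n = Abs_fps (\<lambda>k. of_nat ((n + k) choose k) * c ^ k)"

lemma fps_neg_binom_nth [simp]: "fps_neg_binom c n $ k = of_nat ((n + k) choose k) * c ^ k"
  by (simp add: fps_neg_binom_def)

lemma fps_nth_mult_one_minus_const_X:
  fixes f :: "'a::comm_ring_1 fps"
  shows "(f * (1 - fps_const c * fps_X)) $ n = f $ n - (if n = 0 then 0 else c * f $ (n - 1))"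
proof -
  have "f * (1 - fps_const c * fps_X) = f - fps_const c * (fps_X * f)"
    by (simp add: algebra_simps)
  then show ?thesis by simp
qed

lemma fps_neg_binom_0_mult: "fps_neg_binom c 0 * (1 - fps_const c * fps_X) = 1"
proof (rule fps_ext)
  fix n show "(fps_neg_binom c 0 * (1 - fps_const c * fps_X)) $ n = 1 $ n"
    by (cases n) (simp_all add: fps_nth_mult_one_minus_const_X)
qed

text \<open>Coefficientwise this is Pascal's rule.\<close>

lemma fps_neg_binom_Suc_mult:
  "fps_neg_binom c (Suc n) * (1 - fps_const c * fps_X) = fps_neg_binom c n"
proof (rule fps_ext)
  fix k show "(fps_neg_binom c (Suc n) * (1 - fps_const c * fps_X)) $ k = fps_neg_binom c n $ k"
    by (cases k) (simp_all add: fps_nth_mult_one_minus_const_X algebra_simps)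
qed

lemma fps_neg_binom_eq_power: "fps_neg_binom c n = fps_neg_binom c 0 ^ Suc n"
proof (induction n)
  case (Suc n)
  have "fps_neg_binom c (Suc n) =
      fps_neg_binom c (Suc n) * (1 - fps_const c * fps_X) * fps_neg_binom c 0"
    by (metis (no_types) fps_neg_binom_0_mult mult.assoc mult.commute mult_1_right)
  then show ?case
    by (simp only: fps_neg_binom_Suc_mult Suc power_Suc2[of _ "Suc n"])
qed simp

lemma fps_deriv_neg_binom:
  "fps_deriv (fps_neg_binom c n) = fps_const (c * of_nat (Suc n)) * fps_neg_binom c (Suc n)"
proof (rule fps_ext)
  fix k
  have "Suc n + k - k = Suc n" by simp
  \<comment> \<open>Both sides equal \<open>Suc (n + k) * (n + k choose k)\<close>.\<close>
  then have "Suc k * (Suc n + k choose Suc k) = Suc n * (Suc n + k choose k)"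
    using binomial_absorb_comp[of "Suc n + k" k] Suc_times_binomial_eq[of "n + k" k]
    by (simp add: mult.commute del: binomial_Suc_Suc)
  then have "(of_nat (Suc k) * of_nat (n + Suc k choose Suc k) :: 'a) =
      of_nat (Suc n) * of_nat (Suc n + k choose k)"
    by (metis add_Suc_shift of_nat_mult)
  then have "c ^ Suc k * (of_nat (Suc k) * of_nat (n + Suc k choose Suc k)) =
      c ^ Suc k * (of_nat (Suc n) * of_nat (Suc n + k choose k))"
    by (rule arg_cong)
  then show "fps_deriv (fps_neg_binom c n) $ k =
      (fps_const (c * of_nat (Suc n)) * fps_neg_binom c (Suc n)) $ k"
    by (simp only: fps_deriv_nth fps_mult_left_const_nth fps_neg_binom_nth Suc_eq_plus1[symmetric] power_Suc)
       (simp only: mult_ac)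
qed

lemma fps_nth_deriv_neg_binom_0:
  "fps_nth_deriv k (fps_neg_binom c 0) = fps_const (c ^ k * of_nat (fact k)) * fps_neg_binom c k"
proof (induction k)
  case 0
  then show ?case by simp
next
  case (Suc k)
  have "fps_nth_deriv (Suc k) (fps_neg_binom c 0) =
      fps_const (c ^ k * of_nat (fact k)) * (fps_const (c * of_nat (Suc k)) * fps_neg_binom c (Suc k))"
    by (simp only: fps_nth_deriv_commute Suc fps_deriv_mult_const_left fps_deriv_neg_binom)
  also have "\<dots> = fps_const (c ^ Suc k * of_nat (fact (Suc k))) * fps_neg_binom c (Suc k)"
    by (simp only: mult.assoc[symmetric] fps_const_mult) (simp add: algebra_simps)
  finally show ?case .
qed

text \<open>The base of the power is (1/x) / (1 - t/x) = 1 / (x - t), so these are the coefficients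
  of (x - t)^(-r).\<close>

lemma fps_neg_binom_scaled_power_nth:
  fixes x :: "'a::field"
  assumes "x \<noteq> 0" "0 < r"
  shows "((fps_const (inverse x) * fps_neg_binom (inverse x) 0) ^ r) $ m =
    of_nat ((r + m - 1) choose m) * x powi (- int r - int m)"
proof -
  obtain q where q: "r = Suc q" using assms(2) by (cases r) auto
  have "((fps_const (inverse x) * fps_neg_binom (inverse x) 0) ^ r) $ m =
      inverse x ^ r * (of_nat ((q + m) choose m) * inverse x ^ m)"
    unfolding q power_mult_distrib fps_neg_binom_eq_power[symmetric] fps_const_power
    by simp
  moreover have "x powi (- int r - int m) = inverse x ^ r * inverse x ^ m"
  proof -
    have "- int r - int m = - int (r + m)" by simp
    then show ?thesis
      by (simp only: power_int_minus power_int_of_nat power_inverse power_add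
            inverse_mult_distrib)
  qed
  ultimately show ?thesis using q by (simp add: mult_ac)
qed

text \<open>In the Leibniz rule for G / (1 - t) + G / (1 + t), differentiating 1 / (1 - ct) i - l
  times produces c^(i-l) (i-l)!, and this factorial turns the binomial coefficient into i!/l!. The
  hypothesis \<open>fact\<close> expresses characteristic 0.\<close>

lemma fps_nth_deriv_half_sum:
  fixes F G :: "'a::field fps"
  assumes FG: "2 * F = G * (fps_neg_binom 1 0 + fps_neg_binom (- 1) 0)"
    and fact: "\<And>l. (of_nat (fact l) :: 'a) \<noteq> 0"
  shows "2 * fps_nth_deriv i F = (\<Sum>l = 0..i. fps_const (of_nat (fact i) / of_nat (fact l)) *
    (fps_nth_deriv l G * fps_neg_binom 1 (i - l) +
      fps_const ((- 1) ^ (i - l)) * (fps_nth_deriv l G * fps_neg_binom (- 1) (i - l))))"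
proof -
  have "2 * fps_nth_deriv i F = fps_nth_deriv i (2 * F)"
    by (simp only: mult_2 fps_nth_deriv_add)
  also have "\<dots> = (\<Sum>l = 0..i. of_nat (i choose l) * (fps_nth_deriv l G *
      fps_nth_deriv (i - l) (fps_neg_binom 1 0 + fps_neg_binom (- 1) 0)))"
    unfolding FG by (rule fps_nth_deriv_mult)
  also have "\<dots> = (\<Sum>l = 0..i. fps_const (of_nat (fact i) / of_nat (fact l)) *
    (fps_nth_deriv l G * fps_neg_binom 1 (i - l) +
      fps_const ((- 1) ^ (i - l)) * (fps_nth_deriv l G * fps_neg_binom (- 1) (i - l))))"
  proof (rule sum.cong[OF refl])
    fix l assume "l \<in> {0..i}"
    then have "of_nat (fact l) * of_nat (fact (i - l)) * of_nat (i choose l) = (of_nat (fact i) :: 'a)"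
      using binomial_fact_lemma[of l i] by (simp flip: of_nat_mult)
    then have "of_nat (i choose l) * of_nat (fact (i - l)) = (of_nat (fact i) / of_nat (fact l) :: 'a)"
      using fact by (simp add: field_simps)
    then have *: "fps_const (of_nat (fact i) / of_nat (fact l)) =
        (of_nat (i choose l) * fps_const (of_nat (fact (i - l))) :: 'a fps)"
      by (simp flip: fps_of_nat)
    show "of_nat (i choose l) * (fps_nth_deriv l G *
        fps_nth_deriv (i - l) (fps_neg_binom 1 0 + fps_neg_binom (- 1) 0)) =
      fps_const (of_nat (fact i) / of_nat (fact l)) *
      (fps_nth_deriv l G * fps_neg_binom 1 (i - l) +
        fps_const ((- 1) ^ (i - l)) * (fps_nth_deriv l G * fps_neg_binom (- 1) (i - l)))"
      unfolding * fps_nth_deriv_add fps_nth_deriv_neg_binom_0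
      by (simp only: fps_const_mult[symmetric] power_one fps_const_1_eq_1 mult_1_left distrib_left mult_ac)
  qed
  finally show ?thesis .
qed

section \<open>The differential equations\<close>

text \<open>Each induction step differentiates the identity and multiplies by \<open>C\<close>, the
  inverse of x - t, which cancels the factor x - t in the derivative of the power of
  \<open>F\<close>. On the right, a derivative falling on \<open>C ^ (2 * N - i)\<close> contributes
  (2N - i) a_i(N), and one falling on the i-th derivative of \<open>F\<close> contributes a_i(N) at
  index i + 1; this is the recurrence \<open>A_rec\<close>.\<close>

lemma fps_power_eq_sum_higher_deriv:
  fixes F C :: "'a::comm_ring_1 fps" and A :: "nat \<Rightarrow> nat \<Rightarrow> 'a"
  assumes F: "F * (1 - fps_const (2 * x) * fps_X + fps_X ^ 2) = 1"
    and C: "C * (fps_const x - fps_X) = 1"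
    and A_0: "\<And>N. A 0 N = 0" and A_gt: "\<And>N. A (Suc N) N = 0" and A_1: "A 1 1 = 1"
    and A_rec: "\<And>i N. 1 \<le> N \<Longrightarrow> 1 \<le> i \<Longrightarrow> i \<le> Suc N \<Longrightarrow>
      A i (Suc N) = of_nat (2 * N - i) * A i N + A (i - 1) N"
    and N: "1 \<le> N"
  shows "of_nat (2 ^ N * fact N) * F ^ (N + 1) =
    (\<Sum>i = 1..N. fps_const (A i N) * (C ^ (2 * N - i) * fps_nth_deriv i F))"
proof -
  let ?d = "1 - fps_const (2 * x) * fps_X + fps_X ^ 2" and ?e = "fps_const x - fps_X"
  \<comment> \<open>\<open>F\<close> and \<open>C\<close> are units, so the cofactor
    \<open>u\<close> can be removed by multiplying with its inverse \<open>f\<close>.\<close>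
  have cancel: "g = h" if "f * u = 1" "f * (g * u) = h" for f u g h :: "'a fps"
    using that by (simp only: mult.left_commute[of f g u] mult_1_right)
  have C_e: "C * (?e * g) = g" for g
    using C by (simp only: mult.assoc[symmetric] mult_1_left)
  have d': "fps_deriv ?d = - (2 * ?e)"
    unfolding power2_eq_square mult_2 fps_const_add[symmetric] fps_deriv_add fps_deriv_sub
      fps_deriv_mult fps_deriv_const fps_deriv_fps_X fps_deriv_1
    by (simp only: mult_1_left mult_1_right mult_zero_left mult_zero_right add_0_left)
       (simp add: diff_diff_eq2)
  \<comment> \<open>Differentiating \<open>F * ?d = 1\<close> yields F' without any division; the
    same is done below for \<open>C * ?e = 1\<close>.\<close>
  have "fps_deriv (F * ?d) = 0" unfolding F by simp
  then have "fps_deriv F * ?d = 2 * ?e * F"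
    unfolding fps_deriv_mult d' by (simp add: algebra_simps)
  then have "F * (fps_deriv F * ?d) = 2 * ?e * F ^ 2"
    by (simp add: power2_eq_square mult_ac)
  then have dF: "fps_deriv F = 2 * ?e * F ^ 2"
    by (rule cancel[OF F])
  have "fps_deriv (C * ?e) = 0" unfolding C by simp
  then have "fps_deriv C * ?e = C" by simp
  then have "C * (fps_deriv C * ?e) = C ^ 2" by (simp add: power2_eq_square)
  then have dC: "fps_deriv C = C ^ 2"
    by (rule cancel[OF C])
  have dCm: "fps_deriv (C ^ m) = of_nat m * C ^ Suc m" for m
    by (induction m) (simp_all add: dC power2_eq_square algebra_simps)
  have dFm: "fps_deriv (F ^ Suc m) = of_nat (2 * Suc m) * ?e * F ^ (m + 2)" for m
  proof (induction m)
    case 0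
    then show ?case by (simp add: dF power2_eq_square)
  next
    case (Suc m)
    have "fps_deriv (F ^ Suc (Suc m)) = F * fps_deriv (F ^ Suc m) + fps_deriv F * F ^ Suc m"
      by (simp only: power_Suc[of F "Suc m"] fps_deriv_mult)
    also have "\<dots> = of_nat (2 * Suc (Suc m)) * ?e * F ^ (Suc m + 2)"
      unfolding Suc dF by (simp add: power2_eq_square algebra_simps)
    finally show ?case .
  qed
  show ?thesis
    using N
  proof (induction N rule: nat_induct_at_least)
    case base
    have "C * fps_deriv F = 2 * F ^ 2"
      unfolding dF using C_e[of "2 * F ^ 2"] by (simp only: mult_ac)
    then show ?case using A_1 by (simp add: power2_eq_square)
  next
    case (Suc N)
    let ?D = "\<lambda>i. fps_nth_deriv i F"
    have "fps_deriv (of_nat (2 ^ N * fact N) * F ^ Suc N) =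
        of_nat (2 ^ N * fact N) * (of_nat (2 * Suc N) * ?e * F ^ (N + 2))"
      by (simp only: fps_of_nat[symmetric] fps_deriv_mult_const_left dFm)
    also have "\<dots> = ?e * (of_nat (2 ^ Suc N * fact (Suc N)) * F ^ (Suc N + 1))"
      by (simp add: algebra_simps)
    finally have "of_nat (2 ^ Suc N * fact (Suc N)) * F ^ (Suc N + 1) =
        C * fps_deriv (of_nat (2 ^ N * fact N) * F ^ Suc N)"
      by (simp only: C_e)
    also have "of_nat (2 ^ N * fact N) * F ^ Suc N =
        (\<Sum>i = 1..N. fps_const (A i N) * (C ^ (2 * N - i) * ?D i))"
      using Suc.IH by simp
    also have "C * fps_deriv \<dots> = (\<Sum>i = 1..N. C * (fps_const (A i N) *
        (C ^ (2 * N - i) * ?D (Suc i) + of_nat (2 * N - i) * C ^ Suc (2 * N - i) * ?D i)))"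
      by (simp only: fps_deriv_sum fps_deriv_mult_const_left fps_deriv_mult dCm sum_distrib_left fps_deriv_const mult_zero_left add_0_right
            fps_nth_deriv_commute)
    also have "\<dots> = (\<Sum>i = 1..N. fps_const (of_nat (2 * N - i) * A i N) * (C ^ (2 * Suc N - i) * ?D i) +
        fps_const (A i N) * (C ^ (2 * Suc N - Suc i) * ?D (Suc i)))"
    proof (rule sum.cong[OF refl])
      fix i assume "i \<in> {1..N}"
      \<comment> \<open>Since i <= N, none of these differences truncates.\<close>
      then have "2 * Suc N - i = Suc (Suc (2 * N - i))" "2 * Suc N - Suc i = Suc (2 * N - i)" by auto
      then show "C * (fps_const (A i N) *
          (C ^ (2 * N - i) * ?D (Suc i) + of_nat (2 * N - i) * C ^ Suc (2 * N - i) * ?D i)) =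
        fps_const (of_nat (2 * N - i) * A i N) * (C ^ (2 * Suc N - i) * ?D i) +
        fps_const (A i N) * (C ^ (2 * Suc N - Suc i) * ?D (Suc i))"
        by (simp only: fps_const_mult[symmetric] fps_of_nat power_Suc distrib_left mult_ac add_ac)
    qed
    also have "\<dots> = (\<Sum>i = 1..N. fps_const (of_nat (2 * N - i) * A i N) * (C ^ (2 * Suc N - i) * ?D i)) +
        (\<Sum>i = 1..N. fps_const (A i N) * (C ^ (2 * Suc N - Suc i) * ?D (Suc i)))"
      by (rule sum.distrib)
    \<comment> \<open>Both sums are brought to the range 1..N+1: the first gains a zero term at i =
      N + 1 by \<open>A_gt\<close>, the second a zero term at i = 0 by \<open>A_0\<close>, followed
      by an index shift.\<close>
    also have "(\<Sum>i = 1..N. fps_const (of_nat (2 * N - i) * A i N) * (C ^ (2 * Suc N - i) * ?D i)) =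
        (\<Sum>i = 1..Suc N. fps_const (of_nat (2 * N - i) * A i N) * (C ^ (2 * Suc N - i) * ?D i))"
      by (simp add: A_gt)
    also have "(\<Sum>i = 1..N. fps_const (A i N) * (C ^ (2 * Suc N - Suc i) * ?D (Suc i))) =
        (\<Sum>i = 0..N. fps_const (A i N) * (C ^ (2 * Suc N - Suc i) * ?D (Suc i)))"
      by (simp only: sum.atLeast_Suc_atMost[of 0 N] zero_le A_0 fps_const_0_eq_0 mult_zero_left add_0_left One_nat_def)
    also have "\<dots> = (\<Sum>i = 1..Suc N. fps_const (A (i - 1) N) * (C ^ (2 * Suc N - i) * ?D i))"
      by (simp only: One_nat_def sum.shift_bounds_cl_Suc_ivl diff_Suc_Suc diff_zero)
    also have "(\<Sum>i = 1..Suc N. fps_const (of_nat (2 * N - i) * A i N) * (C ^ (2 * Suc N - i) * ?D i)) + \<dots> =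
        (\<Sum>i = 1..Suc N. fps_const (A i (Suc N)) * (C ^ (2 * Suc N - i) * ?D i))"
      unfolding sum.distrib[symmetric]
    proof (rule sum.cong[OF refl])
      fix i assume "i \<in> {1..Suc N}"
      then have "A i (Suc N) = of_nat (2 * N - i) * A i N + A (i - 1) N"
        using A_rec Suc.hyps by simp
      then show "fps_const (of_nat (2 * N - i) * A i N) * (C ^ (2 * Suc N - i) * ?D i) +
          fps_const (A (i - 1) N) * (C ^ (2 * Suc N - i) * ?D i) =
        fps_const (A i (Suc N)) * (C ^ (2 * Suc N - i) * ?D i)"
        by (simp only: fps_const_add[symmetric] distrib_right)
    qed
    finally show ?case .
  qed
qed

section \<open>Passage to the field of fractions\<close>

text \<open>Characteristic 0 passes to the fraction field; this supplies the hypothesis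
  \<open>fact\<close> of \<open>fps_nth_deriv_half_sum\<close>.\<close>

lemma of_nat_fract_poly_neq_0:
  "m \<noteq> 0 \<Longrightarrow> (of_nat m :: 'a::field_char_0 poly fract) \<noteq> 0"
  by (simp add: of_nat_fract Zero_fract_def eq_fract)

text \<open>A power series is a unit only if its constant coefficient is. Over the polynomials x - t
  is therefore not invertible, and the series are moved coefficientwise to rational
  functions.\<close>

definition fps_to_fract :: "'a::idom fps \<Rightarrow> 'a fract fps" where
  "fps_to_fract f = Abs_fps (\<lambda>n. to_fract (f $ n))"

lemma fps_to_fract_nth [simp]: "fps_to_fract f $ n = to_fract (f $ n)"
  by (simp add: fps_to_fract_def)

lemma to_fract_sum: "to_fract (sum f S) = (\<Sum>i\<in>S. to_fract (f i))"
  by (induction S rule: infinite_finite_induct) simp_all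

lemma fps_to_fract_mult: "fps_to_fract (f * g) = fps_to_fract f * fps_to_fract g"
  by (rule fps_ext) (simp add: fps_mult_nth to_fract_sum)

lemma fps_to_fract_1: "fps_to_fract 1 = 1"
  by (rule fps_ext) simp

lemma fps_to_fract_power: "fps_to_fract (f ^ n) = fps_to_fract f ^ n"
  by (induction n) (simp_all add: fps_to_fract_mult fps_to_fract_1)

lemma fps_to_fract_cheb_denom:
  "fps_to_fract cheb_denom = 1 - fps_const (2 * ratfun_x) * fps_X + fps_X ^ 2"
proof (rule fps_ext)
  fix n
  have "to_fract (2 * [:0, 1:]) = 2 * (ratfun_x :: 'a poly fract)"
    unfolding ratfun_x_def mult_2 by (rule to_fract_add)
  then show "fps_to_fract cheb_denom $ n =
      (1 - fps_const (2 * ratfun_x) * fps_X + fps_X ^ 2 :: 'a poly fract fps) $ n"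
    by (simp add: cheb_denom_def fps_X_power_iff del: to_fract_mult mult_pCons_left mult_pCons_right)
qed

lemma fps_to_fract_one_minus_X2: "fps_to_fract (1 - fps_X ^ 2) = 1 - fps_X ^ 2"
  by (rule fps_ext) (simp add: fps_X_power_iff)

section \<open>Comparison of coefficients\<close>

theorem theorem7:
  fixes n N :: nat
  assumes "N \<ge> 1"
  shows
    "2 ^ (N + 1) * of_nat (fact N) *
       (\<Sum>(s, m, p) \<in> {(s, m, p). s + m + p = n}.
          of_nat ((N + s) choose s) * of_nat ((m + N) choose m) * (- 1) ^ m *
          to_fract (cheb_T_ord (N + 1) p))
     = (\<Sum>i = 1..N. \<Sum>l = 0..i.
          ratfun_const (coeff_a i N) * (of_nat (fact i) / of_nat (fact l)) *
          (\<Sum>(m, s, p) \<in> {(m, s, p). m + s + p = n}.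
             of_nat ((2 * N + m - i - 1) choose m) * of_nat ((i + s - l) choose s) *
             falling (of_nat (p + l)) l *
             ratfun_x powi (int i - 2 * int N - int m) * to_fract (cheb_T (p + l))))
     + (\<Sum>i = 1..N. \<Sum>l = 0..i.
          ratfun_const (coeff_a i N) * (of_nat (fact i) / of_nat (fact l)) * (- 1) ^ (i - l) *
          (\<Sum>(m, s, p) \<in> {(m, s, p). m + s + p = n}.
             (- 1) ^ s *
             of_nat ((2 * N + m - i - 1) choose m) * of_nat ((i + s - l) choose s) *
             falling (of_nat (p + l)) l *
             ratfun_x powi (int i - 2 * int N - int m) *
             (to_fract (cheb_T (p + l)) :: 'a::field_char_0 poly fract)))"
proof -
  let ?x = "ratfun_x :: 'a poly fract"
  have x: "?x \<noteq> 0" by (simp add: ratfun_x_def)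
  \<comment> \<open>In closed form F = 1 / (1 - 2xt + t^2), G = (1 - t^2) F and C = 1 / (x - t);
    below, \<open>P k\<close> and \<open>Q k\<close> are (1 - t)^(-k-1) and (1 + t)^(-k-1).\<close>
  define G F C :: "'a poly fract fps"
    where "G = fps_to_fract cheb_gf"
      and "F = fps_to_fract (fps_right_inverse cheb_denom 1)"
      and "C = fps_const (inverse ?x) * fps_neg_binom (inverse ?x) 0"
  define P Q :: "nat \<Rightarrow> 'a poly fract fps"
    where "P = fps_neg_binom 1" and "Q = fps_neg_binom (- 1)"
  define A :: "nat \<Rightarrow> nat \<Rightarrow> 'a poly fract" where "A i N = ratfun_const (coeff_a0 i N)" for i N
  have "cheb_denom * fps_right_inverse cheb_denom 1 = (1 :: 'a poly fps)"
    by (rule fps_right_inverse) (simp add: cheb_denom_def)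
  then have F: "F * (1 - fps_const (2 * ?x) * fps_X + fps_X ^ 2) = 1"
    unfolding F_def fps_to_fract_cheb_denom[symmetric] fps_to_fract_mult[symmetric]
    by (simp only: mult.commute fps_to_fract_1)
  have P: "P 0 * (1 - fps_X) = 1" and Q: "Q 0 * (1 + fps_X) = 1"
    using fps_neg_binom_0_mult[of "1 :: 'a poly fract"] fps_neg_binom_0_mult[of "- 1 :: 'a poly fract"]
    by (simp_all add: P_def Q_def flip: fps_const_neg)
  have "G = (1 - fps_X ^ 2) * F"
    unfolding G_def F_def cheb_gf_def fps_to_fract_mult fps_to_fract_one_minus_X2 ..
  also have "1 - fps_X ^ 2 = (1 - fps_X) * (1 + fps_X :: 'a poly fract fps)"
    by (simp add: power2_eq_square algebra_simps)
  finally have G: "G = (1 - fps_X) * (1 + fps_X) * F" .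
  have "G * P 0 = (P 0 * (1 - fps_X)) * ((1 + fps_X) * F)" unfolding G by (simp only: mult_ac)
  then have GP: "G * P 0 = (1 + fps_X) * F" unfolding P by simp
  have "G * Q 0 = (Q 0 * (1 + fps_X)) * ((1 - fps_X) * F)" unfolding G by (simp only: mult_ac)
  then have GQ: "G * Q 0 = (1 - fps_X) * F" unfolding Q by simp
  \<comment> \<open>This is 2F = (1 + t) F + (1 - t) F.\<close>
  have FG: "2 * F = G * (P 0 + Q 0)"
    unfolding distrib_left GP GQ by (simp add: algebra_simps)
  have "P 0 * Q 0 * G = Q 0 * (G * P 0)" by (simp only: mult_ac)
  also have "\<dots> = F" unfolding GP mult.assoc[symmetric] Q by simp
  finally have PQG: "P 0 * Q 0 * G = F" .
  have "C * (fps_const ?x - fps_X) = fps_neg_binom (inverse ?x) 0 *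
      (fps_const (inverse ?x) * (fps_const ?x - fps_X))"
    unfolding C_def by (simp only: mult_ac)
  also have "fps_const (inverse ?x) * (fps_const ?x - fps_X) = 1 - fps_const (inverse ?x) * fps_X"
    using x by (simp add: right_diff_distrib)
  finally have C: "C * (fps_const ?x - fps_X) = 1"
    unfolding fps_neg_binom_0_mult .
  have to_fract_of_nat: "to_fract [:of_nat m:] = (of_nat m :: 'a poly fract)" for m
    by (simp add: to_fract_def of_nat_fract of_nat_poly)
  have main: "of_nat (2 ^ N * fact N) * F ^ (N + 1) =
      (\<Sum>i = 1..N. fps_const (A i N) * (C ^ (2 * N - i) * fps_nth_deriv i F))"
  proof (rule fps_power_eq_sum_higher_deriv[OF F C _ _ _ _ assms])
    fix i M :: nat
    assume "1 \<le> M" "1 \<le> i" "i \<le> Suc M"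
    then have "(coeff_a0 i (Suc M) :: 'a) = of_nat (2 * M - i) * coeff_a0 i M + coeff_a0 (i - 1) M"
      by (rule coeff_a0_rec)
    moreover have "[:of_nat (2 * M - i) * coeff_a0 i M + coeff_a0 (i - 1) M:] =
        [:of_nat (2 * M - i):] * [:coeff_a0 i M:] + [:coeff_a0 (i - 1) M :: 'a:]"
      by simp
    ultimately show "A i (Suc M) = of_nat (2 * M - i) * A i M + A (i - 1) M"
      unfolding A_def by (simp only: to_fract_add to_fract_mult to_fract_of_nat)
  qed (simp_all add: A_def coeff_a0_def coeff_a_def odd_dfact_def flip: one_pCons)
  have lhs: "(\<Sum>(s, m, p) \<in> {(s, m, p). s + m + p = n}.
      of_nat ((N + s) choose s) * of_nat ((m + N) choose m) * (- 1) ^ m *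
      to_fract (cheb_T_ord (N + 1) p)) = F ^ (N + 1) $ n"
  proof -
    have G_power: "G ^ (N + 1) $ p = to_fract (cheb_T_ord (N + 1) p)" for p
      by (simp only: G_def cheb_T_ord_def fps_to_fract_power[symmetric] fps_to_fract_nth)
    have "F ^ (N + 1) = P N * Q N * G ^ (N + 1)"
      unfolding PQG[symmetric] power_mult_distrib Suc_eq_plus1[symmetric]
      by (simp only: P_def Q_def fps_neg_binom_eq_power[symmetric])
    also have "\<dots> $ n = (\<Sum>(s, m, p) \<in> {(s, m, p). s + m + p = n}.
        P N $ s * Q N $ m * G ^ (N + 1) $ p)"
      by (rule fps_nth_mult3)
    finally show ?thesis
      unfolding G_power by (simp add: P_def Q_def add.commute mult.assoc)
  qed
  \<comment> \<open>Each inner sum is a coefficient of a product of three series: m comes from (x -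
    t)^(i-2N), s from (1 - t)^(l-i-1) or (1 + t)^(l-i-1), and p from the l-th derivative of G. The
    sign (-1)^s belongs to 1 + t.\<close>
  have rhs: "(\<Sum>(m, s, p) \<in> {(m, s, p). m + s + p = n}.
      of_nat ((2 * N + m - i - 1) choose m) * of_nat ((i + s - l) choose s) *
      falling (of_nat (p + l)) l *
      ?x powi (int i - 2 * int N - int m) * to_fract (cheb_T (p + l))) =
      (C ^ (2 * N - i) * (fps_nth_deriv l G * P (i - l))) $ n"
    and rhs': "(\<Sum>(m, s, p) \<in> {(m, s, p). m + s + p = n}.
      (- 1) ^ s * of_nat ((2 * N + m - i - 1) choose m) * of_nat ((i + s - l) choose s) *
      falling (of_nat (p + l)) l *
      ?x powi (int i - 2 * int N - int m) * to_fract (cheb_T (p + l))) =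
      (C ^ (2 * N - i) * (fps_nth_deriv l G * Q (i - l))) $ n"
    if "i \<in> {1..N}" "l \<in> {0..i}" for i l
  proof -
    have "C ^ (2 * N - i) $ m = of_nat ((2 * N + m - i - 1) choose m) *
        ?x powi (int i - 2 * int N - int m)" for m
    proof -
      have "2 * N - i + m - 1 = 2 * N + m - i - 1" "- int (2 * N - i) = int i - 2 * int N" "0 < 2 * N - i"
        using that by auto
      then show ?thesis
        unfolding C_def using fps_neg_binom_scaled_power_nth[OF x, of "2 * N - i" m] by simp
    qed
    moreover have "fps_nth_deriv l G $ p = falling (of_nat (p + l)) l * to_fract (cheb_T (p + l))" for p
      by (simp add: fps_nth_deriv_nth G_def cheb_T_def)
    moreover have "P (i - l) $ s = of_nat ((i + s - l) choose s)"
      "Q (i - l) $ s = (- 1) ^ s * of_nat ((i + s - l) choose s)" for s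
      using that by (simp_all add: P_def Q_def mult.commute)
    ultimately show
      "(\<Sum>(m, s, p) \<in> {(m, s, p). m + s + p = n}.
        of_nat ((2 * N + m - i - 1) choose m) * of_nat ((i + s - l) choose s) *
        falling (of_nat (p + l)) l *
        ?x powi (int i - 2 * int N - int m) * to_fract (cheb_T (p + l))) =
        (C ^ (2 * N - i) * (fps_nth_deriv l G * P (i - l))) $ n"
      "(\<Sum>(m, s, p) \<in> {(m, s, p). m + s + p = n}.
        (- 1) ^ s * of_nat ((2 * N + m - i - 1) choose m) * of_nat ((i + s - l) choose s) *
        falling (of_nat (p + l)) l *
        ?x powi (int i - 2 * int N - int m) * to_fract (cheb_T (p + l))) =
        (C ^ (2 * N - i) * (fps_nth_deriv l G * Q (i - l))) $ n"
      unfolding mult.commute[of "fps_nth_deriv l G"] mult.assoc[symmetric] fps_nth_mult3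
      by (auto intro!: sum.cong simp only: mult_ac split: prod.splits)
  qed
  have A_eq: "A i N = ratfun_const (coeff_a i N)" if "i \<in> {1..N}" for i
    using that by (simp add: A_def coeff_a0_def)
  \<comment> \<open>Multiplying the Leibniz expansion by a power of \<open>C\<close> and taking the
    n-th coefficient separates the \<open>P\<close> part from the \<open>Q\<close> part, which
    become the two double sums.\<close>
  have deriv: "2 * (C ^ r * fps_nth_deriv i F) $ n =
      (\<Sum>l = 0..i. of_nat (fact i) / of_nat (fact l) * ((C ^ r * (fps_nth_deriv l G * P (i - l))) $ n +
        (- 1) ^ (i - l) * (C ^ r * (fps_nth_deriv l G * Q (i - l))) $ n))" for r i
  proof -
    have "2 * (C ^ r * fps_nth_deriv i F) $ n = (C ^ r * (2 * fps_nth_deriv i F)) $ n"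
      by (simp only: mult_2 distrib_left fps_add_nth)
    also have "2 * fps_nth_deriv i F = (\<Sum>l = 0..i. fps_const (of_nat (fact i) / of_nat (fact l)) *
        (fps_nth_deriv l G * P (i - l) + fps_const ((- 1) ^ (i - l)) * (fps_nth_deriv l G * Q (i - l))))"
      using fps_nth_deriv_half_sum[of F G i] FG of_nat_fract_poly_neq_0[OF fact_nonzero]
      unfolding P_def Q_def by blast
    finally show ?thesis
      by (simp only: sum_distrib_left fps_sum_nth distrib_left fps_add_nth fps_mult_left_const_nth
            mult.left_commute[of "C ^ r" "fps_const _"])
  qed
  \<comment> \<open>One factor 2 is kept apart from 2^(N+1), since the expansion by P and Q is
    available for 2F.\<close>
  have "2 ^ (N + 1) * of_nat (fact N) * F ^ (N + 1) $ n =
      2 * (of_nat (2 ^ N * fact N) * F ^ (N + 1)) $ n"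
    by (simp flip: fps_of_nat)
  also have "\<dots> = (\<Sum>i = 1..N. A i N * (2 * (C ^ (2 * N - i) * fps_nth_deriv i F) $ n))"
    unfolding main by (simp add: fps_sum_nth sum_distrib_left mult.left_commute)
  also have "\<dots> = (\<Sum>i = 1..N. \<Sum>l = 0..i.
        A i N * (of_nat (fact i) / of_nat (fact l)) *
        (C ^ (2 * N - i) * (fps_nth_deriv l G * P (i - l))) $ n) +
      (\<Sum>i = 1..N. \<Sum>l = 0..i.
        A i N * (of_nat (fact i) / of_nat (fact l)) * (- 1) ^ (i - l) *
        (C ^ (2 * N - i) * (fps_nth_deriv l G * Q (i - l))) $ n)"
    unfolding deriv sum_distrib_left sum.distrib[symmetric] distrib_left mult.assoc ..
  finally show ?thesis
    unfolding lhs by (simp only: rhs rhs' A_eq cong: sum.cong)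
qed

end
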